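(* Let $k$ and $v$ be positive integers. There does not exist an optimal $(v,k,1)$-optical orthogonal code whenever one of the following conditions holds: - $k \equiv 3 \pmod 8$ and $v\equiv 3k(k-1) + 2 \pmod{4k(k-1)}$. - $k \equiv 3 \pmod 8$ and $v\equiv 2k(k-1) + 2 \pmod{4k(k-1)}$. - $k \equiv 5 \pmod 8$ and $v\equiv k(k-1) + 2 \pmod{2k(k-1)}$. - $k \equiv 7 \pmod 8$ and $v\equiv k(k-1) + 2 \pmod{4k(k-1)}$. - $k \equiv 7 \pmod 8$ and $v\equiv 2k(k-1) + 2 \pmod{4k(k-1)}$.
   Context: A $(v,k,1)$-optical orthogonal code ($(v,k,1)$-OOC) of size $n$ is a set $\mathcal{C}$ of $n$ $(0,1)$-vectors of length $v$, each of Hamming weight $k$, such that (with subscripts reduced modulo $v$): for every $\mathbf{x}=(x_0,\dots,x_{v-1}) \in \mathcal{C}$ and every integer $0<\tau<v$, $\sum_{i=0}^{v-1} x_i x_{i+\tau} \le 1$; and for all $\mathbf{x}\ne\mathbf{y}$ in $\mathcal{C}$ and every integer $0\le\tau<v$, $\sum_{i=0}^{v-1} x_i y_{i+\tau} \le 1$. The size of a $(v,k,1)$-OOC is always at most $\left\lfloor \frac{v-1}{k(k-1)} \right\rfloor$; it is called optimal if its size equals $\left\lfloor \frac{v-1}{k(k-1)} \right\rfloor$. *)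

theory Defs
  imports Main "HOL-Number_Theory.Cong"
begin

text \<open>A vector of length \<open>v\<close> is a list of length \<open>v\<close>, with coordinates indexed by \<open>{..<v}\<close>.\<close>

definition hamming_weight :: "nat list \<Rightarrow> nat" where
  "hamming_weight x = card {i. i < length x \<and> x ! i \<noteq> 0}"

definition periodic_correlation :: "nat \<Rightarrow> nat list \<Rightarrow> nat list \<Rightarrow> nat \<Rightarrow> nat" where
  "periodic_correlation v x y \<tau> = (\<Sum>i<v. x ! i * y ! ((i + \<tau>) mod v))"

definition is_ooc :: "nat \<Rightarrow> nat \<Rightarrow> nat \<Rightarrow> nat list set \<Rightarrow> bool" where
  "is_ooc v k n C \<longleftrightarrow>
     finite C \<and> card C = n \<and>
     (\<forall>x\<in>C. length x = v \<and> set x \<subseteq> {0, 1} \<and> hamming_weight x = k) \<and>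
     (\<forall>x\<in>C. \<forall>\<tau>. 0 < \<tau> \<and> \<tau> < v \<longrightarrow> periodic_correlation v x x \<tau> \<le> 1) \<and>
     (\<forall>x\<in>C. \<forall>y\<in>C. x \<noteq> y \<longrightarrow> (\<forall>\<tau><v. periodic_correlation v x y \<tau> \<le> 1))"

text \<open>\<open>div\<close> on naturals is the floor of the quotient. The bound is only meaningful for
  \<open>v \<ge> 1\<close> and \<open>k \<ge> 2\<close>: for \<open>k \<le> 1\<close> the divisor is \<open>0\<close> and \<open>div\<close> returns \<open>0\<close>.\<close>

definition is_optimal_ooc :: "nat \<Rightarrow> nat \<Rightarrow> nat list set \<Rightarrow> bool" where
  "is_optimal_ooc v k C \<longleftrightarrow> is_ooc v k ((v - 1) div (k * (k - 1))) C"

end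

theory Submission
  imports Defs
begin

text \<open>
  Write \<open>v = n k (k - 1) + 2\<close> with \<open>k \<ge> 3\<close> odd, so that an optimal code has \<open>n\<close> codewords.
  The correlation conditions say that the differences \<open>j - i\<close> (mod \<open>v\<close>) of distinct support
  positions, taken over all codewords, are pairwise distinct. There are \<open>n k (k - 1) = v - 2\<close>
  of them, all nonzero. As \<open>v / 2\<close> is its own negative, it would arise from \<open>(i, j)\<close> as well as
  from \<open>(j, i)\<close>, so it is not a difference, and therefore every residue other than \<open>0\<close> and
  \<open>v / 2\<close> is a difference exactly once (\<open>bij_betw_differences\<close>).

  Now count the odd differences. A codeword with \<open>a\<close> even and \<open>k - a\<close> odd support positions
  contributes \<open>2 a (k - a)\<close>, which is divisible by \<open>4\<close> because \<open>k\<close> is odd. Hence \<open>4\<close> divides the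
  number of odd residues other than \<open>v / 2\<close>. That number is \<open>v / 2\<close> if \<open>4\<close> divides \<open>v\<close>, and
  \<open>v / 2 - 1\<close> otherwise, which leaves only \<open>v \<equiv> 0\<close> or \<open>v \<equiv> 2\<close> modulo \<open>8\<close>
  (\<open>ooc_length_mod_8\<close>). Each of the five families has \<open>v \<equiv> 4\<close> or \<open>v \<equiv> 6\<close> modulo \<open>8\<close>.
\<close>

section \<open>Differences modulo v\<close>

text \<open>The residue of \<open>j - i\<close> modulo \<open>v\<close> in \<open>{0..<v}\<close>, for \<open>i \<le> v\<close>; adding \<open>v - i\<close> avoids
  truncated subtraction.\<close>

definition cyc_diff :: "nat \<Rightarrow> nat \<Rightarrow> nat \<Rightarrow> nat" where
  "cyc_diff v i j = (j + (v - i)) mod v"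

lemma cyc_diff_less: "i < v \<Longrightarrow> cyc_diff v i j < v"
  by (simp add: cyc_diff_def)

lemma add_cyc_diff:
  assumes "i < v" "j < v"
  shows "(i + cyc_diff v i j) mod v = j"
proof -
  have "(i + cyc_diff v i j) mod v = (i + (j + (v - i))) mod v"
    by (simp add: cyc_diff_def mod_add_right_eq)
  also have "i + (j + (v - i)) = j + v" using assms by simp
  finally show ?thesis using assms by simp
qed

lemma cyc_diff_pos:
  assumes "i < v" "j < v" "i \<noteq> j"
  shows "0 < cyc_diff v i j"
  using add_cyc_diff[OF assms(1,2)] assms by (cases "cyc_diff v i j = 0") auto

lemma odd_cyc_diff_iff:
  assumes "even v" "i < v"
  shows "odd (cyc_diff v i j) \<longleftrightarrow> odd (i + j)"
  using assms by (simp add: cyc_diff_def dvd_mod_iff) presburger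

lemma cyc_diff_swap:
  assumes "i < v" "j < v" "i \<noteq> j"
  shows "cyc_diff v j i = v - cyc_diff v i j"
proof (cases "i < j")
  case True
  then have "cyc_diff v i j = j - i"
    using assms mod_add_self2[of "j - i" v] by (simp add: cyc_diff_def)
  moreover have "cyc_diff v j i = v - (j - i)" using True assms by (simp add: cyc_diff_def)
  ultimately show ?thesis by simp
next
  case False
  then have "cyc_diff v j i = i - j"
    using assms mod_add_self2[of "i - j" v] by (simp add: cyc_diff_def)
  moreover have "cyc_diff v i j = v - (i - j)" using False assms by (simp add: cyc_diff_def)
  ultimately show ?thesis using False assms by simp
qed

section \<open>The differences of a code\<close>

text \<open>The set of positions at which a vector is nonzero.\<close>

definition supp :: "nat list \<Rightarrow> nat set" where
  "supp x = {i. i < length x \<and> x ! i \<noteq> 0}"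

lemma finite_supp [simp]: "finite (supp x)"
  by (simp add: supp_def)

lemma periodic_correlation_ge_2:
  assumes "length x = v" "i \<in> supp x" "i' \<in> supp x" "i \<noteq> i'"
    and "(i + \<tau>) mod v \<in> supp y" "(i' + \<tau>) mod v \<in> supp y"
  shows "2 \<le> periodic_correlation v x y \<tau>"
proof -
  let ?f = "\<lambda>i. x ! i * y ! ((i + \<tau>) mod v)"
  have "1 \<le> ?f i" "1 \<le> ?f i'" using assms by (auto simp: supp_def Suc_le_eq)
  then have "2 \<le> ?f i + ?f i'" by linarith
  then have "2 \<le> sum ?f {i, i'}" using assms(4) by simp
  also have "\<dots> \<le> sum ?f {..<v}"
    using assms(1-3) by (intro sum_mono2) (auto simp: supp_def)
  finally show ?thesis by (simp add: periodic_correlation_def)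
qed

text \<open>The ordered pairs of distinct support positions, tagged with their codeword.\<close>

definition support_pairs :: "nat list set \<Rightarrow> (nat list \<times> nat \<times> nat) set" where
  "support_pairs C = (SIGMA x:C. {(i, j). i \<in> supp x \<and> j \<in> supp x \<and> i \<noteq> j})"

text \<open>The difference belonging to such a pair.\<close>

definition pair_diff :: "nat \<Rightarrow> nat list \<times> nat \<times> nat \<Rightarrow> nat" where
  "pair_diff v = (\<lambda>(x, i, j). cyc_diff v i j)"

lemma finite_distinct_pairs:
  "finite {(i, j). i \<in> supp x \<and> j \<in> supp x \<and> i \<noteq> j}"
  by (rule finite_subset[of _ "supp x \<times> supp x"]) auto

lemma card_distinct_pairs:
  "card {(i, j). i \<in> supp x \<and> j \<in> supp x \<and> i \<noteq> j} = card (supp x) * (card (supp x) - 1)"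
proof -
  have "{(i, j). i \<in> supp x \<and> j \<in> supp x \<and> i \<noteq> j} = (SIGMA i:supp x. supp x - {i})"
    by auto
  then show ?thesis by simp
qed

lemma oocD:
  assumes "is_ooc v k n C"
  shows "finite C" "card C = n"
    and "\<And>x. x \<in> C \<Longrightarrow> length x = v" "\<And>x. x \<in> C \<Longrightarrow> card (supp x) = k"
    and "\<And>x i. x \<in> C \<Longrightarrow> i \<in> supp x \<Longrightarrow> i < v"
    and "\<And>x \<tau>. x \<in> C \<Longrightarrow> 0 < \<tau> \<Longrightarrow> \<tau> < v \<Longrightarrow> periodic_correlation v x x \<tau> \<le> 1"
    and "\<And>x y \<tau>. x \<in> C \<Longrightarrow> y \<in> C \<Longrightarrow> x \<noteq> y \<Longrightarrow> \<tau> < v \<Longrightarrow> periodic_correlation v x y \<tau> \<le> 1"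
  using assms by (auto simp: is_ooc_def hamming_weight_def supp_def)

lemma card_support_pairs:
  assumes "is_ooc v k n C"
  shows "card (support_pairs C) = n * k * (k - 1)"
  using oocD(1,2,4)[OF assms]
  by (simp add: support_pairs_def card_SigmaI finite_distinct_pairs card_distinct_pairs)

lemma inj_on_pair_diff:
  assumes ooc: "is_ooc v k n C"
  shows "inj_on (pair_diff v) (support_pairs C)"
proof -
  have "x = y \<and> i = i' \<and> j = j'"
    if x: "x \<in> C" "i \<in> supp x" "j \<in> supp x" "i \<noteq> j"
      and y: "y \<in> C" "i' \<in> supp y" "j' \<in> supp y" "i' \<noteq> j'"
      and eq: "cyc_diff v i j = cyc_diff v i' j'" for x i j y i' j'
  proof -
    define t where "t = cyc_diff v i j"
    have lt: "i < v" "j < v" "i' < v" "j' < v"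
      using oocD(5)[OF ooc] x y by auto
    have t: "0 < t" "t < v" "(i + t) mod v = j" "(i' + t) mod v = j'"
      using cyc_diff_pos[OF lt(1,2) x(4)] cyc_diff_less[OF lt(1), of j] add_cyc_diff[OF lt(1,2)]
        add_cyc_diff[OF lt(3,4)] eq by (simp_all add: t_def)
    have "x = y"
    proof (rule ccontr)
      assume ne: "x \<noteq> y"
      \<comment> \<open>The shift that takes \<open>i\<close> to \<open>i'\<close> also takes \<open>j\<close> to \<open>j'\<close>.\<close>
      define s where "s = cyc_diff v i i'"
      have s: "s < v" "(i + s) mod v = i'"
        using lt by (simp_all add: s_def cyc_diff_less add_cyc_diff)
      have "(j + s) mod v = ((i + s) mod v + t) mod v"
        unfolding t(3)[symmetric] by (simp add: mod_simps ac_simps)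
      then have "(j + s) mod v = j'" using s(2) t(4) by simp
      then have "2 \<le> periodic_correlation v x y s"
        using periodic_correlation_ge_2[of x v i j s y] oocD(3)[OF ooc] x y s(2) by simp
      then show False using oocD(7)[OF ooc x(1) y(1) ne s(1)] by simp
    qed
    moreover have "i = i'"
    proof (rule ccontr)
      assume "i \<noteq> i'"
      then have "2 \<le> periodic_correlation v x x t"
        using periodic_correlation_ge_2[of x v i i' t x] oocD(3)[OF ooc] x y t \<open>x = y\<close> by simp
      then show False using oocD(6)[OF ooc x(1) t(1,2)] by simp
    qed
    ultimately show ?thesis using t by auto
  qed
  then show ?thesis
    unfolding inj_on_def support_pairs_def pair_diff_def by fast
qed

text \<open>When \<open>v\<close> exceeds the number of differences by \<open>2\<close>, the differences are all the residues
  except the two that equal their own negative.\<close>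

lemma bij_betw_differences:
  assumes ooc: "is_ooc v k n C" and v: "v = n * k * (k - 1) + 2"
  shows "bij_betw (pair_diff v) (support_pairs C) ({0<..<v} - {v div 2})"
proof -
  have "even v" unfolding v by (cases "even k") auto
  have sub: "pair_diff v ` support_pairs C \<subseteq> {0<..<v} - {v div 2}"
  proof clarify
    fix x i j
    assume p: "(x, i, j) \<in> support_pairs C"
    then have q: "(x, j, i) \<in> support_pairs C" and ne: "i \<noteq> j"
      by (auto simp: support_pairs_def)
    have lt: "i < v" "j < v"
      using p oocD(5)[OF ooc] by (auto simp: support_pairs_def)
    have "cyc_diff v i j \<noteq> v div 2"
    proof
      assume half: "cyc_diff v i j = v div 2"
      then have "cyc_diff v j i = v div 2"
        using cyc_diff_swap[OF lt ne] \<open>even v\<close> by (elim evenE) simp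
      then have "(x, i, j) = (x, j, i)"
        using half by (intro inj_onD[OF inj_on_pair_diff[OF ooc] _ p q]) (simp add: pair_diff_def)
      then show False using ne by simp
    qed
    then show "pair_diff v (x, i, j) \<in> {0<..<v} - {v div 2}"
      using lt ne by (simp add: pair_diff_def cyc_diff_pos cyc_diff_less)
  qed
  have "v div 2 \<in> {0<..<v}" using v by auto
  then have "card ({0<..<v} - {v div 2}) = v - 2" by (simp add: card_Diff_singleton)
  also have "\<dots> = card (pair_diff v ` support_pairs C)"
    using card_image[OF inj_on_pair_diff[OF ooc]] card_support_pairs[OF ooc] v by simp
  finally have "pair_diff v ` support_pairs C = {0<..<v} - {v div 2}"
    using sub by (intro card_subset_eq) auto
  then show ?thesis using inj_on_pair_diff[OF ooc] by (simp add: bij_betw_def)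
qed

section \<open>Counting odd differences\<close>

lemma four_dvd_card_odd_pairs:
  fixes S :: "nat set"
  assumes "finite S" "odd (card S)"
  shows "4 dvd card {(i, j). i \<in> S \<and> j \<in> S \<and> odd (i + j)}"
proof -
  define A B where "A = {i \<in> S. even i}" and "B = {i \<in> S. odd i}"
  have fin: "finite A" "finite B" and disj: "A \<inter> B = {}" and S: "S = A \<union> B"
    using assms(1) by (auto simp: A_def B_def)
  have "card S = card A + card B" using fin disj S card_Un_disjoint by metis
  then have "even (card A * card B)" using assms(2) by auto
  moreover have "{(i, j). i \<in> S \<and> j \<in> S \<and> odd (i + j)} = A \<times> B \<union> B \<times> A"
    by (auto simp: A_def B_def)
  moreover have "card (A \<times> B \<union> B \<times> A) = 2 * (card A * card B)"
    using fin disj by (subst card_Un_disjoint) (auto simp: card_cartesian_product)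
  ultimately show ?thesis by auto
qed

lemma card_odd_less: "card {d::nat. d < 2 * m \<and> odd d} = m"
proof -
  have "{d::nat. d < 2 * m \<and> odd d} = (\<lambda>i. 2 * i + 1) ` {..<m}"
    by (auto elim!: oddE)
  then show ?thesis by (simp add: card_image inj_on_def)
qed

lemma ooc_length_mod_8:
  assumes ooc: "is_ooc v k n C" and v: "v = n * k * (k - 1) + 2" and k: "odd k"
  shows "v mod 8 = 0 \<or> v mod 8 = 2"
proof -
  have "even v" unfolding v using k by simp
  then obtain m where m: "v = 2 * m" by blast
  let ?P = "{p \<in> support_pairs C. odd (pair_diff v p)}"
  let ?D = "{d \<in> {0<..<v} - {v div 2}. odd d}"
  have P: "?P = (SIGMA x:C. {(i, j). i \<in> supp x \<and> j \<in> supp x \<and> odd (i + j)})"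
    using odd_cyc_diff_iff[OF \<open>even v\<close>] oocD(5)[OF ooc]
    by (auto simp: support_pairs_def pair_diff_def)
  have fin: "finite {(i, j). i \<in> supp x \<and> j \<in> supp x \<and> odd (i + j)}" for x
    by (rule finite_subset[of _ "supp x \<times> supp x"]) auto
  have "card ?P = (\<Sum>x\<in>C. card {(i, j). i \<in> supp x \<and> j \<in> supp x \<and> odd (i + j)})"
    unfolding P using oocD(1)[OF ooc] fin by (simp add: card_SigmaI)
  then have "4 dvd card ?P"
    using oocD(4)[OF ooc] k
    by (simp only:) (intro dvd_sum four_dvd_card_odd_pairs finite_supp, simp)
  moreover have "bij_betw (pair_diff v) ?P ?D"
  proof -
    have img: "{0<..<v} - {v div 2} = pair_diff v ` support_pairs C"
      using bij_betw_differences[OF ooc v] by (simp add: bij_betw_def)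
    show ?thesis
      unfolding img bij_betw_def using inj_on_pair_diff[OF ooc] by (blast intro: inj_on_subset)
  qed
  ultimately have "4 dvd card ?D" by (simp add: bij_betw_same_card)
  moreover have "?D = {d. d < 2 * m \<and> odd d} - {m}"
    using m by (auto elim!: oddE)
  moreover have "card ({d. d < 2 * m \<and> odd d} - {m}) = (if odd m then m - 1 else m)"
    using card_odd_less[of m] by (auto simp: card_Diff_singleton_if elim!: oddE)
  ultimately have "4 dvd (if odd m then m - 1 else m)" by simp
  then show ?thesis unfolding m by (cases "odd m") (auto elim!: oddE, presburger+)
qed

section \<open>The arithmetic of the five families\<close>

text \<open>The residue of \<open>v\<close> modulo \<open>b k (k - 1)\<close> fixes the floor of \<open>(v - 1) / (k (k - 1))\<close>, which
  is the size of an optimal code, modulo \<open>b\<close>. The assumption \<open>3 \<le> k\<close> makes \<open>k (k - 1) > 2\<close>, so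
  that the summand \<open>2\<close> does not carry over.\<close>

lemma optimal_size_from_cong:
  fixes k v b c :: nat
  assumes "3 \<le> k" "c < b" "[v = c * k * (k - 1) + 2] (mod (b * k * (k - 1)))"
  obtains q where "v = (b * q + c) * k * (k - 1) + 2"
    and "(v - 1) div (k * (k - 1)) = b * q + c"
proof -
  define M where "M = k * (k - 1)"
  have "3 * 2 \<le> k * (k - 1)" using assms(1) by (intro mult_le_mono) auto
  then have M: "6 \<le> M" by (simp add: M_def)
  have "c * M + M \<le> b * M" using assms(2) mult_le_mono1[of "Suc c" b M] by simp
  then have "c * M + 2 < b * M" using M by linarith
  then have r: "v mod (b * M) = c * M + 2"
    using assms(3) by (simp add: cong_def M_def mult.assoc)
  define q where "q = v div (b * M)"
  have "v = (b * M) * q + (c * M + 2)"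
    using r mult_div_mod_eq[of "b * M" v] by (simp add: q_def)
  then have v: "v = (b * q + c) * M + 2" by (simp add: algebra_simps)
  then have "v - 1 = 1 + (b * q + c) * M" by simp
  then have "(v - 1) div M = b * q + c" using M div_mult_self1[of M 1 "b * q + c"] by simp
  with v show ?thesis by (intro that[of q]) (simp_all add: M_def mult.assoc)
qed

lemma no_optimal_ooc:
  fixes k v b c :: nat
  assumes "3 \<le> k" "odd k" "c < b" "[v = c * k * (k - 1) + 2] (mod (b * k * (k - 1)))"
    and "\<And>q. ((b * q + c) * k * (k - 1) + 2) mod 8 \<in> {4, 6}"
  shows "\<not> is_optimal_ooc v k C"
proof
  assume opt: "is_optimal_ooc v k C"
  obtain q where v: "v = (b * q + c) * k * (k - 1) + 2"
    and n: "(v - 1) div (k * (k - 1)) = b * q + c"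
    using optimal_size_from_cong[OF assms(1,3,4)] by blast
  have "v mod 8 = 0 \<or> v mod 8 = 2"
    using opt n by (intro ooc_length_mod_8[OF _ v assms(2)]) (simp add: is_optimal_ooc_def)
  then show False using assms(5)[of q] v by auto
qed

lemma cong_odd_mod_8:
  fixes k r :: nat
  assumes "[k = r] (mod 8)" "odd r"
  shows "r mod 8 \<le> k" "odd k"
proof -
  show "r mod 8 \<le> k"
    using assms(1) mod_less_eq_dividend[of k 8] by (simp add: cong_def)
  show "odd k"
    using assms dvd_mod_iff[of 2 8 k] dvd_mod_iff[of 2 8 r] by (simp add: cong_def)
qed

lemma mult_pred_mod_8:
  fixes k n :: nat
  assumes "[k = r] (mod 8)" "0 < r" "0 < k"
  shows "(n * k * (k - 1) + 2) mod 8 = (n * (r * (r - 1) mod 8) + 2) mod 8"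
proof -
  have "[k - 1 = r - 1] (mod 8)"
    using assms by (intro cong_diff_nat) auto
  then have "[k * (k - 1) = r * (r - 1) mod 8] (mod 8)"
    using cong_mult[OF assms(1)] by (simp add: cong_def)
  then have "[n * (k * (k - 1)) + 2 = n * (r * (r - 1) mod 8) + 2] (mod 8)"
    by (intro cong_add cong_mult) auto
  then show ?thesis by (simp add: cong_def mult.assoc)
qed

theorem theorem4p5:
  fixes k v :: nat
  assumes "k > 0" and "v > 0"
    and "([k = 3] (mod 8) \<and> [v = 3 * k * (k - 1) + 2] (mod (4 * k * (k - 1)))) \<or>
         ([k = 3] (mod 8) \<and> [v = 2 * k * (k - 1) + 2] (mod (4 * k * (k - 1)))) \<or>
         ([k = 5] (mod 8) \<and> [v = k * (k - 1) + 2] (mod (2 * k * (k - 1)))) \<or>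
         ([k = 7] (mod 8) \<and> [v = k * (k - 1) + 2] (mod (4 * k * (k - 1)))) \<or>
         ([k = 7] (mod 8) \<and> [v = 2 * k * (k - 1) + 2] (mod (4 * k * (k - 1))))"
  shows "\<not> (\<exists>C. is_optimal_ooc v k C)"
proof -
  have "\<not> is_optimal_ooc v k C" for C
    using assms(3)
  proof (elim disjE conjE)
    assume k: "[k = 3] (mod 8)" and v: "[v = 3 * k * (k - 1) + 2] (mod (4 * k * (k - 1)))"
    have "3 \<le> k" "odd k" using cong_odd_mod_8[OF k] by simp_all
    moreover have "((4 * q + 3) * k * (k - 1) + 2) mod 8 \<in> {4, 6}" for q
      unfolding mult_pred_mod_8[OF k zero_less_numeral assms(1)] by simp presburger
    ultimately show ?thesis using v by (intro no_optimal_ooc[of k 3 4]) auto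
  next
    assume k: "[k = 3] (mod 8)" and v: "[v = 2 * k * (k - 1) + 2] (mod (4 * k * (k - 1)))"
    have "3 \<le> k" "odd k" using cong_odd_mod_8[OF k] by simp_all
    moreover have "((4 * q + 2) * k * (k - 1) + 2) mod 8 \<in> {4, 6}" for q
      unfolding mult_pred_mod_8[OF k zero_less_numeral assms(1)] by simp presburger
    ultimately show ?thesis using v by (intro no_optimal_ooc[of k 2 4]) auto
  next
    assume k: "[k = 5] (mod 8)" and v: "[v = k * (k - 1) + 2] (mod (2 * k * (k - 1)))"
    have "3 \<le> k" "odd k" using cong_odd_mod_8[OF k] by simp_all
    moreover have "((2 * q + 1) * k * (k - 1) + 2) mod 8 \<in> {4, 6}" for q
      unfolding mult_pred_mod_8[OF k zero_less_numeral assms(1)] by simp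
    ultimately show ?thesis using v by (intro no_optimal_ooc[of k 1 2]) auto
  next
    assume k: "[k = 7] (mod 8)" and v: "[v = k * (k - 1) + 2] (mod (4 * k * (k - 1)))"
    have "3 \<le> k" "odd k" using cong_odd_mod_8[OF k] by simp_all
    moreover have "((4 * q + 1) * k * (k - 1) + 2) mod 8 \<in> {4, 6}" for q
      unfolding mult_pred_mod_8[OF k zero_less_numeral assms(1)] by simp
    ultimately show ?thesis using v by (intro no_optimal_ooc[of k 1 4]) auto
  next
    assume k: "[k = 7] (mod 8)" and v: "[v = 2 * k * (k - 1) + 2] (mod (4 * k * (k - 1)))"
    have "3 \<le> k" "odd k" using cong_odd_mod_8[OF k] by simp_all
    moreover have "((4 * q + 2) * k * (k - 1) + 2) mod 8 \<in> {4, 6}" for q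
      unfolding mult_pred_mod_8[OF k zero_less_numeral assms(1)] by simp
    ultimately show ?thesis using v by (intro no_optimal_ooc[of k 2 4]) auto
  qed
  then show ?thesis by blast
qed

end
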